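(* Let $X$ be a Banach space, let $\varphi:\mathbb{R}_+\times\mathbb{R}\to\mathbb{R}$ be a real semiflow, and let $\mathcal{U}=\{U(t,s)\}_{t\ge s}$ be an evolution family on $X$. Assume that one of the following holds: either $\varphi$ is a non-degenerate semiflow with $\lim_{s\to\infty}\varphi_t(s)=+\infty$ for every $t\ge 0$, or $\varphi$ is a (degenerate) real semiflow with $\lim_{s\to\infty}\omega(s)=+\infty$. If there are real constants $\alpha>0$ and $K\ge 1$ such that $$\|U(s,\varphi_t(s))\|\le Ke^{\alpha t}\quad\text{for all } t\ge 0,\ s\in\mathbb{R},$$ then the family $\{T_t\}_{t\ge 0}$ defined by $$T_tu(s)=U(s,\varphi_t(s))\,u(\varphi_t(s)),\quad s\in\mathbb{R},$$ is a $C_0$-semigroup on $C_0(\mathbb{R},X)$.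
   Context: $\mathbb{R}_+=[0,\infty)$ and $\varphi_t(s)=\varphi(t,s)$. A real semiflow is a continuous mapping $\varphi:\mathbb{R}_+\times\mathbb{R}\to\mathbb{R}$ such that (i) $\varphi_0(s)=s$ for all $s\in\mathbb{R}$; (ii) $\varphi_t\circ\varphi_\tau=\varphi_{t+\tau}$ for all $t,\tau\ge 0$; and (iii) $\varphi_t(s)\le s$ for all $t\ge 0$, $s\in\mathbb{R}$. The orbit of $s$ is $o(s)=\{\varphi_t(s): t\ge 0\}$; it is trivial if $o(s)=\{s\}$. A real semiflow is non-degenerate if it has no trivial orbits, and degenerate otherwise. For $s\in\mathbb{R}$, $\omega(s)=\lim_{t\to\infty}\varphi_t(s)\in\mathbb{R}\cup\{-\infty\}$ (the limit exists because $t\mapsto\varphi_t(s)$ is non-increasing). A (strongly continuous) evolution family on $X$ is a collection of bounded linear operators $U(t,s)$, $t\ge s$ in $\mathbb{R}$, on $X$ such that $U(t,t)=\mathrm{Id}$ for all $t$; $U(t,\tau)U(\tau,t_0)=U(t,t_0)$ for $t\ge\tau\ge t_0$; and for each $x\in X$ the map $(t,s)\mapsto U(t,s)x$ is continuous on $\{(t,s)\in\mathbb{R}^2: t\ge s\}$. $C_0(\mathbb{R},X)$ is the Banach space of continuous functions $u:\mathbb{R}\to X$ with $\lim_{|s|\to\infty}u(s)=0$, with the sup-norm. A $C_0$-semigroup is a strongly continuous one-parameter semigroup of bounded linear operators. *)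

theory Defs
  imports "HOL-Analysis.Analysis"
begin

subsection \<open>The Banach space of continuous functions vanishing at infinity\<close>

definition C0 :: "(real \<Rightarrow> 'a::real_normed_vector) set"
  where "C0 = {u. continuous_on UNIV u \<and> (u \<longlongrightarrow> 0) at_infinity}"

lemma C0_bdd_above:
  assumes "u \<in> C0"
  shows "bdd_above (range (\<lambda>s. norm (u s)))"
proof -
  from assms have cont: "continuous_on UNIV u" and lim: "(u \<longlongrightarrow> 0) at_infinity"
    by (auto simp: C0_def)
  from tendstoD[OF lim zero_less_one] obtain b where b: "\<And>s. b \<le> norm s \<Longrightarrow> norm (u s) < 1"
    by (auto simp: eventually_at_infinity)
  have "compact (u ` cball 0 b)"
    by (intro compact_continuous_image continuous_on_subset[OF cont]) auto
  then have "bounded (u ` cball 0 b)" by (rule compact_imp_bounded)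
  then obtain B where "\<forall>x\<in>u ` cball 0 b. norm x \<le> B" by (auto simp only: bounded_iff)
  then have B: "\<And>s. s \<in> cball 0 b \<Longrightarrow> norm (u s) \<le> B" by (meson imageI)
  have "norm (u s) \<le> max B 1" for s
  proof (cases "b \<le> norm s")
    case True
    with b[of s] show ?thesis by simp
  next
    case False
    then have "s \<in> cball 0 b" by simp
    from B[OF this] show ?thesis by simp
  qed
  then show ?thesis
    by (auto intro!: bdd_aboveI)
qed

typedef (overloaded) ('a::real_normed_vector) c0_fun = "C0 :: (real \<Rightarrow> 'a) set"
  morphisms c0_apply Abs_c0
  by (rule exI[of _ "\<lambda>_. 0"]) (simp add: C0_def)

setup_lifting type_definition_c0_fun

lemma c0_fun_eqI: "(\<And>s. c0_apply u s = c0_apply v s) \<Longrightarrow> u = v"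
  by transfer auto

instantiation c0_fun :: (real_normed_vector) real_vector
begin

lift_definition zero_c0_fun :: "'a c0_fun" is "\<lambda>_. 0"
  by (simp add: C0_def)

lift_definition plus_c0_fun :: "'a c0_fun \<Rightarrow> 'a c0_fun \<Rightarrow> 'a c0_fun" is "\<lambda>u v s. u s + v s"
  by (auto simp: C0_def intro!: continuous_intros tendsto_add_zero)

lift_definition uminus_c0_fun :: "'a c0_fun \<Rightarrow> 'a c0_fun" is "\<lambda>u s. - u s"
  by (auto simp: C0_def intro!: continuous_intros tendsto_eq_intros)

lift_definition minus_c0_fun :: "'a c0_fun \<Rightarrow> 'a c0_fun \<Rightarrow> 'a c0_fun" is "\<lambda>u v s. u s - v s"
  by (auto simp: C0_def intro!: continuous_intros tendsto_eq_intros)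

lift_definition scaleR_c0_fun :: "real \<Rightarrow> 'a c0_fun \<Rightarrow> 'a c0_fun" is "\<lambda>r u s. r *\<^sub>R u s"
  by (auto simp: C0_def intro!: continuous_intros tendsto_eq_intros)

instance
  by standard (transfer; auto simp: algebra_simps)+

end

lemmas [simp] =
  zero_c0_fun.rep_eq
  plus_c0_fun.rep_eq
  uminus_c0_fun.rep_eq
  minus_c0_fun.rep_eq
  scaleR_c0_fun.rep_eq

instantiation c0_fun :: (real_normed_vector) real_normed_vector
begin

definition norm_c0_fun :: "'a c0_fun \<Rightarrow> real"
  where "norm_c0_fun u = (SUP s. norm (c0_apply u s))"

definition dist_c0_fun :: "'a c0_fun \<Rightarrow> 'a c0_fun \<Rightarrow> real"
  where "dist_c0_fun u v = norm (u - v)"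

definition sgn_c0_fun :: "'a c0_fun \<Rightarrow> 'a c0_fun"
  where "sgn_c0_fun u = u /\<^sub>R norm u"

definition uniformity_c0_fun :: "('a c0_fun \<times> 'a c0_fun) filter"
  where "uniformity_c0_fun = (INF e\<in>{0 <..}. principal {(u, v). dist u v < e})"

definition open_c0_fun :: "'a c0_fun set \<Rightarrow> bool"
  where "open_c0_fun S = (\<forall>u\<in>S. \<forall>\<^sub>F (u', v) in uniformity. u' = u \<longrightarrow> v \<in> S)"

lemma norm_c0_apply_le: "norm (c0_apply u s) \<le> norm u"
  unfolding norm_c0_fun_def by (intro cSUP_upper C0_bdd_above c0_apply) simp

lemma norm_c0_le: "(\<And>s. norm (c0_apply u s) \<le> b) \<Longrightarrow> norm u \<le> b"
  unfolding norm_c0_fun_def by (intro cSUP_least) auto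

instance
proof
  fix u v :: "'a c0_fun" and a :: real
  have nonneg: "0 \<le> norm w" for w :: "'a c0_fun"
    using norm_c0_apply_le[of w 0] norm_ge_zero order_trans by blast
  show "norm u = 0 \<longleftrightarrow> u = 0"
  proof
    assume "norm u = 0"
    then show "u = 0"
      using norm_c0_apply_le[of u] by (intro c0_fun_eqI) simp
  qed (simp add: norm_c0_fun_def)
  show "norm (u + v) \<le> norm u + norm v"
    by (rule norm_c0_le) (simp add: add_mono norm_c0_apply_le norm_triangle_le)
  have le: "norm (b *\<^sub>R w) \<le> \<bar>b\<bar> * norm w" for b and w :: "'a c0_fun"
    by (rule norm_c0_le) (simp add: mult_left_mono norm_c0_apply_le)
  show "norm (a *\<^sub>R u) = \<bar>a\<bar> * norm u"
  proof (cases "a = 0")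
    case True
    then show ?thesis using le[of a u] nonneg[of "a *\<^sub>R u"] by simp
  next
    case False
    have "norm u \<le> \<bar>inverse a\<bar> * norm (a *\<^sub>R u)"
      using le[of "inverse a" "a *\<^sub>R u"] False by simp
    then have "\<bar>a\<bar> * norm u \<le> norm (a *\<^sub>R u)"
      using False by (simp add: field_simps abs_inverse)
    with le[of a u] show ?thesis by simp
  qed
qed (rule dist_c0_fun_def sgn_c0_fun_def uniformity_c0_fun_def open_c0_fun_def)+

end

instance c0_fun :: (banach) banach
proof
  fix f :: "nat \<Rightarrow> 'a c0_fun"
  assume "Cauchy f"
  have pt: "dist (c0_apply u s) (c0_apply v s) \<le> dist u v" for u v :: "'a c0_fun" and s
    using norm_c0_apply_le[of "u - v" s] by (simp add: dist_norm)
  from \<open>Cauchy f\<close> have "uniformly_Cauchy_on UNIV (\<lambda>n. c0_apply (f n))"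
    unfolding uniformly_Cauchy_on_def Cauchy_def by (blast intro: le_less_trans[OF pt])
  then obtain g where g: "uniform_limit UNIV (\<lambda>n. c0_apply (f n)) g sequentially"
    using Cauchy_uniformly_convergent uniformly_convergent_on_def by blast
  have f: "continuous_on UNIV (c0_apply (f n))" "(c0_apply (f n) \<longlongrightarrow> 0) at_infinity" for n
    using c0_apply[of "f n"] by (auto simp: C0_def)
  have "continuous_on UNIV g"
    by (rule uniform_limit_theorem[OF _ g]) (simp_all add: f)
  moreover have "(g \<longlongrightarrow> 0) at_infinity"
  proof (rule tendstoI)
    fix e :: real
    assume "0 < e"
    then have "\<forall>\<^sub>F n in sequentially. \<forall>s. dist (c0_apply (f n) s) (g s) < e / 2"
      using uniform_limitD[OF g, of "e / 2"] by simp
    then obtain n where n: "\<And>s. dist (c0_apply (f n) s) (g s) < e / 2"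
      by (auto simp: eventually_sequentially)
    have "\<forall>\<^sub>F s in at_infinity. dist (c0_apply (f n) s) 0 < e / 2"
      using tendstoD[OF f(2), of "e / 2"] \<open>0 < e\<close> by simp
    then show "\<forall>\<^sub>F s in at_infinity. dist (g s) 0 < e"
      by eventually_elim (use n dist_triangle_half_r in blast)
  qed
  ultimately have "g \<in> C0" by (simp add: C0_def)
  then have gA: "c0_apply (Abs_c0 g) = g" by (rule Abs_c0_inverse)
  have "f \<longlonglongrightarrow> Abs_c0 g"
  proof (rule tendstoI)
    fix e :: real
    assume "0 < e"
    then have "\<forall>\<^sub>F n in sequentially. \<forall>s. dist (c0_apply (f n) s) (g s) < e / 2"
      using uniform_limitD[OF g, of "e / 2"] by simp
    then show "\<forall>\<^sub>F n in sequentially. dist (f n) (Abs_c0 g) < e"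
    proof eventually_elim
      case (elim n)
      have "norm (f n - Abs_c0 g) \<le> e / 2"
        using elim by (intro norm_c0_le) (simp add: gA dist_norm less_imp_le)
      then show ?case using \<open>0 < e\<close> by (simp add: dist_norm)
    qed
  qed
  then show "convergent f" by (rule convergentI)
qed


subsection \<open>Semigroups\<close>

text \<open>Only the operators \<open>T t\<close> with \<open>t \<ge> 0\<close> are part of the family; the values of the HOL
  function \<open>T\<close> at negative \<open>t\<close> are irrelevant. The same convention applies to \<open>\<phi>\<close> below
  and, for \<open>t < s\<close>, to \<open>U t s\<close>.\<close>

definition C0_semigroup :: "(real \<Rightarrow> 'b::banach \<Rightarrow> 'b) \<Rightarrow> bool"
  where "C0_semigroup T \<longleftrightarrow>
    (\<forall>t\<ge>0. bounded_linear (T t)) \<and>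
    T 0 = id \<and>
    (\<forall>t\<ge>0. \<forall>\<tau>\<ge>0. T (t + \<tau>) = T t \<circ> T \<tau>) \<and>
    (\<forall>u. continuous_on {0..} (\<lambda>t. T t u))"


subsection \<open>Real semiflows\<close>

definition real_semiflow :: "(real \<Rightarrow> real \<Rightarrow> real) \<Rightarrow> bool"
  where "real_semiflow \<phi> \<longleftrightarrow>
    continuous_on ({0..} \<times> UNIV) (\<lambda>(t, s). \<phi> t s) \<and>
    (\<forall>s. \<phi> 0 s = s) \<and>
    (\<forall>t\<ge>0. \<forall>\<tau>\<ge>0. \<phi> t \<circ> \<phi> \<tau> = \<phi> (t + \<tau>)) \<and>
    (\<forall>t\<ge>0. \<forall>s. \<phi> t s \<le> s)"

definition semiflow_orbit :: "(real \<Rightarrow> real \<Rightarrow> real) \<Rightarrow> real \<Rightarrow> real set"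
  where "semiflow_orbit \<phi> s = {\<phi> t s |t. 0 \<le> t}"

definition non_degenerate :: "(real \<Rightarrow> real \<Rightarrow> real) \<Rightarrow> bool"
  where "non_degenerate \<phi> \<longleftrightarrow> (\<nexists>s. semiflow_orbit \<phi> s = {s})"

abbreviation degenerate :: "(real \<Rightarrow> real \<Rightarrow> real) \<Rightarrow> bool"
  where "degenerate \<phi> \<equiv> \<not> non_degenerate \<phi>"

definition semiflow_omega :: "(real \<Rightarrow> real \<Rightarrow> real) \<Rightarrow> real \<Rightarrow> ereal"
  where "semiflow_omega \<phi> s = Lim at_top (\<lambda>t. ereal (\<phi> t s))"

text \<open>The limit defining \<open>\<omega>(s)\<close> exists in \<open>\<real> \<union> {-\<infinity>}\<close>.\<close>

lemma semiflow_omega: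
  assumes "real_semiflow \<phi>"
  shows "((\<lambda>t. ereal (\<phi> t s)) \<longlongrightarrow> semiflow_omega \<phi> s) at_top"
    and "semiflow_omega \<phi> s < \<infinity>"
proof -
  have comp: "\<phi> t (\<phi> \<tau> s) = \<phi> (t + \<tau>) s" if "0 \<le> t" "0 \<le> \<tau>" for t \<tau>
  proof -
    have "\<phi> t \<circ> \<phi> \<tau> = \<phi> (t + \<tau>)"
      using assms that by (simp add: real_semiflow_def)
    then show ?thesis by (simp add: fun_eq_iff)
  qed
  have mono: "\<phi> t s \<le> \<phi> \<tau> s" if "0 \<le> \<tau>" "\<tau> \<le> t" for t \<tau>
  proof -
    have "\<phi> (t - \<tau>) (\<phi> \<tau> s) \<le> \<phi> \<tau> s"
      using assms that by (simp add: real_semiflow_def)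
    then show ?thesis using comp[of "t - \<tau>" \<tau>] that by simp
  qed
  have lim: "((\<lambda>t. ereal (\<phi> t s)) \<longlongrightarrow> (INF t\<in>{0..}. ereal (\<phi> t s))) at_top"
  proof (rule decreasing_tendsto)
    show "\<forall>\<^sub>F t in at_top. (INF t\<in>{0..}. ereal (\<phi> t s)) \<le> ereal (\<phi> t s)"
      using eventually_ge_at_top[of 0] by eventually_elim (auto intro: INF_lower)
  next
    fix x
    assume "(INF t\<in>{0..}. ereal (\<phi> t s)) < x"
    then obtain \<tau> where "0 \<le> \<tau>" "ereal (\<phi> \<tau> s) < x"
      by (auto simp: INF_less_iff)
    from eventually_ge_at_top[of \<tau>] show "\<forall>\<^sub>F t in at_top. ereal (\<phi> t s) < x"
    proof eventually_elim
      case (elim t)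
      with mono[OF \<open>0 \<le> \<tau>\<close>, of t] have "ereal (\<phi> t s) \<le> ereal (\<phi> \<tau> s)" by simp
      with \<open>ereal (\<phi> \<tau> s) < x\<close> show ?case by (rule le_less_trans[rotated])
    qed
  qed
  then have eq: "semiflow_omega \<phi> s = (INF t\<in>{0..}. ereal (\<phi> t s))"
    unfolding semiflow_omega_def by (intro tendsto_Lim) simp_all
  from lim show "((\<lambda>t. ereal (\<phi> t s)) \<longlongrightarrow> semiflow_omega \<phi> s) at_top"
    by (simp add: eq)
  have "semiflow_omega \<phi> s \<le> ereal (\<phi> 0 s)"
    unfolding eq by (rule INF_lower) simp
  then show "semiflow_omega \<phi> s < \<infinity>"
    by (rule le_less_trans) simp
qed


subsection \<open>Evolution families\<close>

definition evolution_family :: "(real \<Rightarrow> real \<Rightarrow> 'a::banach \<Rightarrow>\<^sub>L 'a) \<Rightarrow> bool"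
  where "evolution_family U \<longleftrightarrow>
    (\<forall>t. U t t = id_blinfun) \<and>
    (\<forall>t \<tau> t\<^sub>0. t\<^sub>0 \<le> \<tau> \<and> \<tau> \<le> t \<longrightarrow> U t \<tau> o\<^sub>L U \<tau> t\<^sub>0 = U t t\<^sub>0) \<and>
    (\<forall>x. continuous_on {(t, s). s \<le> t} (\<lambda>(t, s). blinfun_apply (U t s) x))"

definition weighted_comp ::
  "(real \<Rightarrow> real \<Rightarrow> real) \<Rightarrow> (real \<Rightarrow> real \<Rightarrow> 'a::banach \<Rightarrow>\<^sub>L 'a) \<Rightarrow> real \<Rightarrow> (real \<Rightarrow> 'a) \<Rightarrow> real \<Rightarrow> 'a"
  where "weighted_comp \<phi> U t u = (\<lambda>s. blinfun_apply (U s (\<phi> t s)) (u (\<phi> t s)))"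

text \<open>\<open>Abs_c0\<close> is meaningful only on \<open>C0\<close>, so that \<open>weighted_comp \<phi> U t\<close> maps \<open>C0\<close> to itself
  has to be established separately.\<close>

definition evolution_semigroup ::
  "(real \<Rightarrow> real \<Rightarrow> real) \<Rightarrow> (real \<Rightarrow> real \<Rightarrow> 'a::banach \<Rightarrow>\<^sub>L 'a) \<Rightarrow> real \<Rightarrow> 'a c0_fun \<Rightarrow> 'a c0_fun"
  where "evolution_semigroup \<phi> U t u = Abs_c0 (weighted_comp \<phi> U t (c0_apply u))"

end

theory Submission
  imports Defs
begin

text \<open>Since \<open>\<phi> t s\<close> is non-increasing in \<open>t\<close>, for \<open>t \<in> [0, M]\<close> it lies between \<open>\<phi> M s\<close> and \<open>s\<close>,
  where \<open>\<phi> M s \<rightarrow> \<infinity>\<close> as \<open>s \<rightarrow> \<infinity>\<close> under either hypothesis on \<open>\<phi>\<close> (in the degenerate case because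
  \<open>\<omega>(s) \<le> \<phi> M s\<close>). With the exponential bound, \<open>T\<^sub>t u(s)\<close> therefore vanishes as \<open>\<bar>s\<bar> \<rightarrow> \<infinity>\<close>, uniformly
  in \<open>t \<in> [0, M]\<close>. The exponential bound also upgrades the strong continuity of \<open>U\<close> to joint
  continuity of \<open>(t, s) \<mapsto> T\<^sub>t u(s)\<close>, and uniform continuity on compact rectangles yields the
  strong continuity of the semigroup.\<close>

section \<open>Limits of operators and continuity of curves in \<open>C0\<close>\<close>

lemma tendsto_blinfun_apply_strong:
  fixes F :: "'c \<Rightarrow> 'a::real_normed_vector \<Rightarrow>\<^sub>L 'b::real_normed_vector"
  assumes strong: "((\<lambda>p. F p y) \<longlongrightarrow> z) A"
    and bound: "\<forall>\<^sub>F p in A. norm (F p) \<le> B"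
    and f: "(f \<longlongrightarrow> y) A"
  shows "((\<lambda>p. F p (f p)) \<longlongrightarrow> z) A"
proof -
  \<comment> \<open>Split \<open>F p (f p)\<close> as \<open>F p (f p - y) + F p y\<close>: the norm
    bound sends the first summand to 0, strong convergence handles the second.\<close>
  have "((\<lambda>p. B * norm (f p - y)) \<longlongrightarrow> 0) A"
    by (intro tendsto_mult_right_zero tendsto_norm_zero) (use f in \<open>simp add: LIM_zero\<close>)
  moreover have "\<forall>\<^sub>F p in A. norm (F p (f p - y)) \<le> B * norm (f p - y)"
    using bound
    by eventually_elim (meson mult_right_mono norm_blinfun norm_ge_zero order_trans)
  ultimately have "((\<lambda>p. F p (f p - y)) \<longlongrightarrow> 0) A"
    by (rule Lim_null_comparison[rotated])
  from tendsto_add[OF this strong] show ?thesis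
    by (simp add: blinfun.diff_right)
qed

lemma C0_tail:
  assumes "u \<in> C0" "0 < e"
  obtains b where "\<And>s. b \<le> \<bar>s\<bar> \<Longrightarrow> norm (u s) < e"
proof -
  have "(u \<longlongrightarrow> 0) at_infinity"
    using assms by (simp add: C0_def)
  from tendstoD[OF this \<open>0 < e\<close>] that show ?thesis
    by (auto simp: eventually_at_infinity)
qed

lemma C0I:
  assumes "continuous_on UNIV u"
    and "\<And>e. 0 < e \<Longrightarrow> \<exists>b. \<forall>s. b \<le> \<bar>s\<bar> \<longrightarrow> norm (u s) < e"
  shows "u \<in> C0"
  using assms by (auto simp: C0_def tendsto_iff eventually_at_infinity)

text \<open>The supremum over s is controlled in two regions: where \<bar>s\<bar> is large both
  functions are small by the uniform tail, and on the remaining compact rectangle joint continuity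
  is uniform.\<close>

lemma continuous_on_c0I:
  fixes T :: "real \<Rightarrow> 'a::real_normed_vector c0_fun"
  assumes cont: "continuous_on ({0..} \<times> UNIV) (\<lambda>(t, s). c0_apply (T t) s)"
    and tail: "\<And>M e. 0 \<le> M \<Longrightarrow> 0 < e \<Longrightarrow>
      \<exists>b. \<forall>t\<in>{0..M}. \<forall>s. b \<le> \<bar>s\<bar> \<longrightarrow> norm (c0_apply (T t) s) < e"
  shows "continuous_on {0..} T"
  unfolding continuous_on_iff
proof (intro ballI allI impI)
  fix t e :: real
  assume t: "t \<in> {0..}" and "0 < e"
  \<comment> \<open>The interval up to \<open>t+1\<close> contains every admissible
    \<open>t'\<close> within distance 1 of \<open>t\<close>. Two tails of size \<open>e/4\<close>
    add up to \<open>e/2\<close>, which leaves room for the non-strict bound on the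
    supremum.\<close>
  obtain b where b: "\<And>t' s. t' \<in> {0..t+1} \<Longrightarrow> b \<le> \<bar>s\<bar> \<Longrightarrow> norm (c0_apply (T t') s) < e/4"
    using tail[of "t+1" "e/4"] t \<open>0 < e\<close> by force
  have "uniformly_continuous_on ({0..t+1} \<times> {-b..b}) (\<lambda>(t, s). c0_apply (T t) s)"
    by (intro compact_uniformly_continuous continuous_on_subset[OF cont] compact_Times) auto
  then obtain d where "0 < d"
    and d: "\<And>p q. p \<in> {0..t+1} \<times> {-b..b} \<Longrightarrow> q \<in> {0..t+1} \<times> {-b..b} \<Longrightarrow> dist q p < d \<Longrightarrow>
      dist (case q of (t, s) \<Rightarrow> c0_apply (T t) s) (case p of (t, s) \<Rightarrow> c0_apply (T t) s) < e/2"
    unfolding uniformly_continuous_on_def using \<open>0 < e\<close> by (metis half_gt_zero)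
  show "\<exists>d>0. \<forall>t'\<in>{0..}. dist t' t < d \<longrightarrow> dist (T t') (T t) < e"
  proof (intro exI[of _ "min d 1"] conjI ballI impI)
    fix t' assume t': "t' \<in> {0..}" "dist t' t < min d 1"
    then have le: "t' \<in> {0..t+1}" by (auto simp: dist_real_def)
    have "norm (c0_apply (T t' - T t) s) \<le> e/2" for s
    proof (cases "b \<le> \<bar>s\<bar>")
      case True
      then show ?thesis
        using b[OF le True] b[of t s] t norm_triangle_ineq4[of "c0_apply (T t') s" "c0_apply (T t) s"]
        by simp
    next
      case False
      then have "s \<in> {-b..b}" by auto
      then have "dist (c0_apply (T t') s) (c0_apply (T t) s) < e/2"
        using d[of "(t, s)" "(t', s)"] t t' le by (simp add: dist_Pair_Pair)
      then show ?thesis by (simp add: dist_norm)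
    qed
    then have "norm (T t' - T t) \<le> e/2" by (rule norm_c0_le)
    with \<open>0 < e\<close> show "dist (T t') (T t) < e" by (simp add: dist_norm)
  qed (use \<open>0 < d\<close> in simp)
qed

section \<open>Monotonicity and growth of real semiflows\<close>

context
  fixes \<phi> :: "real \<Rightarrow> real \<Rightarrow> real"
  assumes flow: "real_semiflow \<phi>"
begin

lemma semiflow_le: "0 \<le> t \<Longrightarrow> \<phi> t s \<le> s"
  and semiflow_zero: "\<phi> 0 s = s"
  and semiflow_add: "0 \<le> t \<Longrightarrow> 0 \<le> \<tau> \<Longrightarrow> \<phi> t (\<phi> \<tau> s) = \<phi> (t + \<tau>) s"
  and semiflow_continuous: "continuous_on ({0..} \<times> UNIV) (\<lambda>(t, s). \<phi> t s)"
  using flow by (auto simp: real_semiflow_def fun_eq_iff)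

lemma semiflow_antimono:
  assumes "0 \<le> \<tau>" "\<tau> \<le> t"
  shows "\<phi> t s \<le> \<phi> \<tau> s"
  using semiflow_add[of "t - \<tau>" \<tau> s] semiflow_le[of "t - \<tau>" "\<phi> \<tau> s"] assms by simp

lemma semiflow_omega_le:
  assumes "0 \<le> t"
  shows "semiflow_omega \<phi> s \<le> ereal (\<phi> t s)"
proof (rule tendsto_upperbound[OF semiflow_omega(1)[OF flow]])
  show "\<forall>\<^sub>F r in at_top. ereal (\<phi> r s) \<le> ereal (\<phi> t s)"
    using eventually_ge_at_top[of t]
    by eventually_elim (simp add: semiflow_antimono assms)
qed simp

lemma semiflow_at_top_of_omega:
  assumes "(semiflow_omega \<phi> \<longlongrightarrow> \<infinity>) at_top" "0 \<le> t"
  shows "filterlim (\<phi> t) at_top at_top"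
  unfolding filterlim_at_top
proof
  fix Z
  have "\<forall>\<^sub>F s in at_top. ereal Z < semiflow_omega \<phi> s"
    using assms by (auto intro: order_tendstoD)
  then show "\<forall>\<^sub>F s in at_top. Z \<le> \<phi> t s"
    by eventually_elim (metis semiflow_omega_le[OF \<open>0 \<le> t\<close>] ereal_less_eq(3) less_imp_le order_trans)
qed

text \<open>Only time \<open>M\<close> matters on the right, since
  \<open>\<phi> M s \<le> \<phi> t s\<close>; on the left \<open>\<phi> t s \<le> s\<close>
  suffices.\<close>

lemma semiflow_tail_uniform:
  assumes "filterlim (\<phi> M) at_top at_top"
  obtains b' where "\<And>t s. 0 \<le> t \<Longrightarrow> t \<le> M \<Longrightarrow> b' \<le> \<bar>s\<bar> \<Longrightarrow> b \<le> \<bar>\<phi> t s\<bar>"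
proof -
  obtain c where c: "\<And>s. c \<le> s \<Longrightarrow> \<bar>b\<bar> \<le> \<phi> M s"
    using assms unfolding filterlim_at_top eventually_at_top_linorder by metis
  \<comment> \<open>For s \<ge> 0 the threshold gives \<open>c \<le> s\<close>; for s < 0 it gives
    \<open>s \<le> -\<bar>b\<bar>\<close>.\<close>
  have "b \<le> \<bar>\<phi> t s\<bar>" if "0 \<le> t" "t \<le> M" "max \<bar>b\<bar> \<bar>c\<bar> \<le> \<bar>s\<bar>" for t s
    using that c[of s] semiflow_antimono[of t M s] semiflow_le[of t s] by linarith
  with that show ?thesis by blast
qed

end

section \<open>Weighted composition operators\<close>

locale bounded_evolution =
  fixes \<phi> :: "real \<Rightarrow> real \<Rightarrow> real"
    and U :: "real \<Rightarrow> real \<Rightarrow> 'a::banach \<Rightarrow>\<^sub>L 'a"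
    and \<alpha> K :: real
  assumes flow: "real_semiflow \<phi>"
    and evol: "evolution_family U"
    and at_top: "\<And>t. 0 \<le> t \<Longrightarrow> filterlim (\<phi> t) at_top at_top"
    and pos: "0 \<le> \<alpha>" "0 < K"
    and bound: "\<And>t s. t \<ge> 0 \<Longrightarrow> norm (U s (\<phi> t s)) \<le> K * exp (\<alpha> * t)"
begin

lemma bound_upto:
  assumes "0 \<le> t" "t \<le> M"
  shows "norm (U s (\<phi> t s)) \<le> K * exp (\<alpha> * M)"
proof -
  have "K * exp (\<alpha> * t) \<le> K * exp (\<alpha> * M)"
    using pos assms by (simp add: mult_left_mono)
  with bound[OF assms(1), of s] show ?thesis by simp
qed

lemma norm_weighted_comp_le:
  assumes "0 \<le> t" "t \<le> M"
  shows "norm (weighted_comp \<phi> U t u s) \<le> K * exp (\<alpha> * M) * norm (u (\<phi> t s))"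
  unfolding weighted_comp_def
  using norm_blinfun[of "U s (\<phi> t s)" "u (\<phi> t s)"] mult_right_mono[OF bound_upto[OF assms, of s]]
  by (meson norm_ge_zero order_trans)

text \<open>The curve \<open>(s, \<phi> t s)\<close> stays in the domain of \<open>U\<close> because
  \<open>\<phi> t s \<le> s\<close>, so strong continuity carries over for a fixed vector; a local
  bound on the operator norms then lets the vector vary.\<close>

lemma weighted_comp_continuous:
  assumes u: "continuous_on UNIV u"
  shows "continuous_on ({0..} \<times> UNIV) (\<lambda>(t, s). weighted_comp \<phi> U t u s)"
proof -
  let ?A = "{0..} \<times> UNIV :: (real \<times> real) set"
  let ?\<psi> = "\<lambda>p. \<phi> (fst p) (snd p)"
  have \<psi>: "continuous_on ?A ?\<psi>"
    using semiflow_continuous[OF flow] by (simp add: case_prod_unfold)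
  have strong: "continuous_on ?A (\<lambda>p. U (snd p) (?\<psi> p) x)" for x
  proof -
    have "continuous_on {(t, s). s \<le> t} (\<lambda>(t, s). U t s x)"
      using evol by (simp add: evolution_family_def)
    from continuous_on_compose2[OF this, of ?A "\<lambda>p. (snd p, ?\<psi> p)"] show ?thesis
      by (force intro: continuous_intros \<psi> semiflow_le[OF flow])
  qed
  have "((\<lambda>p. U (snd p) (?\<psi> p) (u (?\<psi> p))) \<longlongrightarrow> U (snd q) (?\<psi> q) (u (?\<psi> q))) (at q within ?A)"
    if q: "q \<in> ?A" for q
  proof (rule tendsto_blinfun_apply_strong)
    \<comment> \<open>Close to \<open>q\<close> the times stay below \<open>fst q + 1\<close>, so
      one constant bounds all the operators there.\<close>
    have "\<forall>\<^sub>F p in at q within ?A. fst p < fst q + 1"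
      by (intro order_tendstoD(2)[OF tendsto_fst[OF tendsto_ident_at]]) simp
    moreover have "\<forall>\<^sub>F p in at q within ?A. p \<in> ?A"
      by (simp add: eventually_at_filter)
    ultimately show "\<forall>\<^sub>F p in at q within ?A. norm (U (snd p) (?\<psi> p)) \<le> K * exp (\<alpha> * (fst q + 1))"
      by eventually_elim (auto intro: bound_upto)
    show "((\<lambda>p. u (?\<psi> p)) \<longlongrightarrow> u (?\<psi> q)) (at q within ?A)"
      using continuous_on_compose2[OF u \<psi>] q unfolding continuous_on_def by blast
    show "((\<lambda>p. U (snd p) (?\<psi> p) (u (?\<psi> q))) \<longlongrightarrow> U (snd q) (?\<psi> q) (u (?\<psi> q))) (at q within ?A)"
      using strong q unfolding continuous_on_def by blast
  qed
  then show ?thesis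
    by (simp add: continuous_on_def weighted_comp_def case_prod_unfold)
qed

lemma weighted_comp_tail:
  assumes u: "u \<in> C0" and "0 \<le> M" "0 < e"
  shows "\<exists>b. \<forall>t\<in>{0..M}. \<forall>s. b \<le> \<bar>s\<bar> \<longrightarrow> norm (weighted_comp \<phi> U t u s) < e"
proof -
  let ?C = "K * exp (\<alpha> * M)"
  have C: "0 < ?C" using pos by simp
  \<comment> \<open>Dividing by \<open>?C\<close> compensates for the growth of the operators up to
    time \<open>M\<close>; \<open>b'\<close> then pulls the tail of \<open>u\<close> back along the
    flow.\<close>
  obtain b where b: "\<And>s. b \<le> \<bar>s\<bar> \<Longrightarrow> norm (u s) < e / ?C"
    using C0_tail[OF u, of "e / ?C"] C \<open>0 < e\<close> by (metis divide_pos_pos)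
  obtain b' where b': "\<And>t s. 0 \<le> t \<Longrightarrow> t \<le> M \<Longrightarrow> b' \<le> \<bar>s\<bar> \<Longrightarrow> b \<le> \<bar>\<phi> t s\<bar>"
    using semiflow_tail_uniform[OF flow at_top[OF \<open>0 \<le> M\<close>]] by metis
  have "norm (weighted_comp \<phi> U t u s) < e" if "t \<in> {0..M}" "b' \<le> \<bar>s\<bar>" for t s
  proof -
    have "norm (weighted_comp \<phi> U t u s) \<le> ?C * norm (u (\<phi> t s))"
      using that by (simp add: norm_weighted_comp_le)
    also have "\<dots> < ?C * (e / ?C)"
      using that by (intro mult_strict_left_mono b b' C) auto
    also have "\<dots> = e" using pos by simp
    finally show ?thesis .
  qed
  then show ?thesis by blast
qed

section \<open>Invariance of \<open>C0\<close> and the semigroup laws\<close>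

lemma weighted_comp_C0:
  assumes "0 \<le> t" "u \<in> C0"
  shows "weighted_comp \<phi> U t u \<in> C0"
proof (rule C0I)
  have "continuous_on ({0..} \<times> UNIV) (\<lambda>(t, s). weighted_comp \<phi> U t u s)"
    using assms by (intro weighted_comp_continuous) (simp add: C0_def)
  moreover have "continuous_on UNIV (Pair t :: real \<Rightarrow> _)"
    by (rule continuous_on_Pair[OF continuous_on_const continuous_on_id])
  ultimately have "continuous_on UNIV (\<lambda>s. case Pair t s of (t, s) \<Rightarrow> weighted_comp \<phi> U t u s)"
    using assms(1) by (rule_tac continuous_on_compose2) auto
  then show "continuous_on UNIV (weighted_comp \<phi> U t u)" by simp
next
  fix e :: real assume "0 < e"
  \<comment> \<open>The uniform tail is taken with \<open>M = t\<close> and read off at the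
    endpoint.\<close>
  from weighted_comp_tail[OF assms(2,1) this] assms(1)
  show "\<exists>b. \<forall>s. b \<le> \<bar>s\<bar> \<longrightarrow> norm (weighted_comp \<phi> U t u s) < e"
    by (meson atLeastAtMost_iff order_refl)
qed

text \<open>Invariance of \<open>C0\<close> makes \<open>Abs_c0\<close> meaningful here, so the
  semigroup properties can be checked pointwise.\<close>

lemma apply_evolution_semigroup:
  "0 \<le> t \<Longrightarrow> c0_apply (evolution_semigroup \<phi> U t u) s = U s (\<phi> t s) (c0_apply u (\<phi> t s))"
  using weighted_comp_C0[OF _ c0_apply]
  by (simp add: evolution_semigroup_def Abs_c0_inverse weighted_comp_def)

lemma C0_semigroup_evolution_semigroup: "C0_semigroup (evolution_semigroup \<phi> U)"
  unfolding C0_semigroup_def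
proof (intro conjI allI impI)
  fix t :: real assume t: "0 \<le> t"
  show "bounded_linear (evolution_semigroup \<phi> U t)"
  proof (rule bounded_linear_intro)
    fix u v :: "'a c0_fun" and r :: real
    show "evolution_semigroup \<phi> U t (u + v) = evolution_semigroup \<phi> U t u + evolution_semigroup \<phi> U t v"
      "evolution_semigroup \<phi> U t (r *\<^sub>R u) = r *\<^sub>R evolution_semigroup \<phi> U t u"
      by (intro c0_fun_eqI; simp add: apply_evolution_semigroup t blinfun.add_right blinfun.scaleR_right)+
    show "norm (evolution_semigroup \<phi> U t u) \<le> norm u * (K * exp (\<alpha> * t))"
    proof (rule norm_c0_le)
      fix s
      have "norm (c0_apply (evolution_semigroup \<phi> U t u) s) \<le>
          K * exp (\<alpha> * t) * norm (c0_apply u (\<phi> t s))"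
        using norm_weighted_comp_le[OF t order_refl, of "c0_apply u" s]
        by (simp add: apply_evolution_semigroup t weighted_comp_def)
      also have "\<dots> \<le> K * exp (\<alpha> * t) * norm u"
        using pos by (intro mult_left_mono norm_c0_apply_le) simp
      finally show "norm (c0_apply (evolution_semigroup \<phi> U t u) s) \<le> norm u * (K * exp (\<alpha> * t))"
        by (simp add: mult.commute)
    qed
  qed
next
  show "evolution_semigroup \<phi> U 0 = id"
    using evol
    by (intro ext c0_fun_eqI) (simp add: apply_evolution_semigroup semiflow_zero[OF flow] evolution_family_def)
next
  fix t \<tau> :: real assume t: "0 \<le> t" "0 \<le> \<tau>"
  have "c0_apply (evolution_semigroup \<phi> U (t + \<tau>) u) s =
      c0_apply (evolution_semigroup \<phi> U t (evolution_semigroup \<phi> U \<tau> u)) s" for u s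
  proof -
    \<comment> \<open>The outer operator moves the base point first, so the flow maps compose in the
      opposite order to the operators; commutativity of addition reconciles the two.\<close>
    have add: "\<phi> \<tau> (\<phi> t s) = \<phi> (t + \<tau>) s"
      using t by (simp add: semiflow_add[OF flow] add.commute)
    have "\<phi> \<tau> (\<phi> t s) \<le> \<phi> t s" "\<phi> t s \<le> s"
      using t by (simp_all add: semiflow_le[OF flow])
    \<comment> \<open>The flow never increases a point, so these three points are ordered as the
      evolution law requires.\<close>
    then have "U s (\<phi> t s) o\<^sub>L U (\<phi> t s) (\<phi> \<tau> (\<phi> t s)) = U s (\<phi> \<tau> (\<phi> t s))"
      using evol unfolding evolution_family_def by blast
    then have "U s (\<phi> (t + \<tau>) s) = U s (\<phi> t s) o\<^sub>L U (\<phi> t s) (\<phi> (t + \<tau>) s)"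
      by (simp add: add)
    with t add show ?thesis
      by (simp add: apply_evolution_semigroup)
  qed
  then show "evolution_semigroup \<phi> U (t + \<tau>) = evolution_semigroup \<phi> U t \<circ> evolution_semigroup \<phi> U \<tau>"
    by (intro ext c0_fun_eqI) simp
next
  fix u :: "'a c0_fun"
  have u: "c0_apply u \<in> C0" by (rule c0_apply)
  show "continuous_on {0..} (\<lambda>t. evolution_semigroup \<phi> U t u)"
  proof (rule continuous_on_c0I)
    have "continuous_on ({0..} \<times> UNIV) (\<lambda>(t, s). weighted_comp \<phi> U t (c0_apply u) s)"
      using u by (intro weighted_comp_continuous) (simp add: C0_def)
    then show "continuous_on ({0..} \<times> UNIV) (\<lambda>(t, s). c0_apply (evolution_semigroup \<phi> U t u) s)"
      by (rule continuous_on_eq) (auto simp: apply_evolution_semigroup weighted_comp_def)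
  next
    fix M e :: real assume "0 \<le> M" "0 < e"
    from weighted_comp_tail[OF u this]
    show "\<exists>b. \<forall>t\<in>{0..M}. \<forall>s. b \<le> \<bar>s\<bar> \<longrightarrow> norm (c0_apply (evolution_semigroup \<phi> U t u) s) < e"
      by (simp add: apply_evolution_semigroup weighted_comp_def)
  qed
qed

end

theorem theorem3p3:
  fixes \<phi> :: "real \<Rightarrow> real \<Rightarrow> real"
    and U :: "real \<Rightarrow> real \<Rightarrow> 'a::banach \<Rightarrow>\<^sub>L 'a"
    and \<alpha> K :: real
  assumes "real_semiflow \<phi>"
    and "evolution_family U"
    and "(non_degenerate \<phi> \<and> (\<forall>t\<ge>0. filterlim (\<phi> t) at_top at_top)) \<or>
         (degenerate \<phi> \<and> (semiflow_omega \<phi> \<longlongrightarrow> \<infinity>) at_top)"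
    and "\<alpha> > 0" and "K \<ge> 1"
    and "\<And>t s. t \<ge> 0 \<Longrightarrow> norm (U s (\<phi> t s)) \<le> K * exp (\<alpha> * t)"
  shows "(\<forall>t\<ge>0. \<forall>u\<in>C0. weighted_comp \<phi> U t u \<in> C0) \<and>
         C0_semigroup (evolution_semigroup \<phi> U)"
proof -
  \<comment> \<open>Both alternatives supply \<open>at_top\<close>: the first by assumption, the
    second through \<open>\<omega>\<close>.\<close>
  interpret bounded_evolution \<phi> U \<alpha> K
    using assms by unfold_locales (auto intro: semiflow_at_top_of_omega)
  show ?thesis
    using weighted_comp_C0 C0_semigroup_evolution_semigroup by blast
qed

end
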